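(* Let $T>0$, $h=T/N$, and let $\theta_n,\hat\theta_n\in\Theta$ ($0\le n\le N$) satisfy $\theta_0=\hat\theta_0$ and, for $0\le n\le N-1$, $$\theta_{n+1}=\theta_n-hG(\theta_n)^{-1}\nabla_\theta H(\theta_n)\quad\text{(forward Euler)},\qquad \hat\theta_{n+1}=\hat\theta_n-hG(\hat\theta_n)^{-1}\nabla_\theta H(\hat\theta_{n+1})\quad\text{(semi-implicit Euler)}.$$ Put $F(\theta)=G(\theta)^{-1}\nabla_\theta H(\theta)$ and, with a vector norm $\|\cdot\|$ and its induced matrix norm, $$L_1=\max_{0\le n\le N-1}\frac{\|F(\theta_n)-F(\hat\theta_n)\|}{\|\theta_n-\hat\theta_n\|},\quad L_2=\max_{0\le n\le N-1}\frac{\|\nabla_\theta H(\hat\theta_n)-\nabla_\theta H(\hat\theta_{n+1})\|}{\|\hat\theta_n-\hat\theta_{n+1}\|},\quad M_1=\max_{0\le n\le N-1}\|G(\hat\theta_n)^{-1}\|,\quad M_2=\max_{1\le n\le N}\|\nabla_\theta H(\hat\theta_n)\|,$$ where quotients $0/0$ are read as $0$, and suppose $L_1>0$. Then $$\|\theta_n-\hat\theta_n\|\le\bigl((1+L_1h)^n-1\bigr)\frac{M_1^2M_2L_2}{L_1}h,\qquad n=1,2,\dots,N.$$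
   Context: $\Theta\subset\mathbb{R}^m$ is an open convex parameter set. $G(\theta)$ is a positive definite symmetric $m\times m$ matrix for every $\theta\in\Theta$, and $H:\Theta\to\mathbb{R}$ is a $C^1$ function. In the paper these arise as follows (all integrals over $\mathbb{R}^d$): $T_\theta:\mathbb{R}^d\to\mathbb{R}^d$ are invertible maps, $T_\theta(x)\in C^2(\Theta\times\mathbb{R}^d)$, $p$ is a reference probability measure with positive density and finite second moment, $\rho_\theta$ is the density of $T_{\theta\sharp}p$, $\psi_j$ solves $\nabla\cdot(\rho_\theta\nabla\psi_j)=\nabla\cdot(\rho_\theta\frac{\partial T_\theta}{\partial\theta_j}\circ T_\theta^{-1})$ with $\lim_{x\to\infty}\rho_\theta\nabla\psi_j=0$, $G_{ij}(\theta)=\int\nabla\psi_i(T_\theta(x))\cdot\nabla\psi_j(T_\theta(x))dp(x)$, and $H(\theta)=D\int\rho_\theta\log(\rho_\theta/\rho_* )dx$ with $D>0$, $\rho_*=\frac1{Z_D}e^{-V/D}$, $Z_D=\int e^{-V/D}dx$, for a potential $V:\mathbb{R}^d\to\mathbb{R}$. *)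

theory Defs
  imports "HOL-Analysis.Analysis"
begin

text \<open>An arbitrary norm on a real vector space, given as a function; it need not be the
  norm of the type class.\<close>
definition is_norm :: "('a::real_vector \<Rightarrow> real) \<Rightarrow> bool" where
  "is_norm \<nu> \<longleftrightarrow>
     (\<forall>x. 0 \<le> \<nu> x) \<and> (\<forall>x. \<nu> x = 0 \<longleftrightarrow> x = 0) \<and>
     (\<forall>c x. \<nu> (c *\<^sub>R x) = \<bar>c\<bar> * \<nu> x) \<and> (\<forall>x y. \<nu> (x + y) \<le> \<nu> x + \<nu> y)"

definition induced_norm :: "(real ^ 'm \<Rightarrow> real) \<Rightarrow> real ^ 'm ^ 'm \<Rightarrow> real" where
  "induced_norm \<nu> A = (SUP x\<in>{x. x \<noteq> 0}. \<nu> (A *v x) / \<nu> x)"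

definition pos_def_sym :: "real ^ 'm ^ 'm \<Rightarrow> bool" where
  "pos_def_sym A \<longleftrightarrow> transpose A = A \<and> (\<forall>x. x \<noteq> 0 \<longrightarrow> 0 < x \<bullet> (A *v x))"

text \<open>The vector of partial derivatives; only meaningful where \<open>f\<close> is differentiable.\<close>
definition grad :: "(real ^ 'm \<Rightarrow> real) \<Rightarrow> real ^ 'm \<Rightarrow> real ^ 'm" where
  "grad f x = (\<chi> i. frechet_derivative f (at x) (axis i 1))"

text \<open>Meant for open \<open>S\<close>: differentiability is taken in the whole space.\<close>
definition C1_on :: "(real ^ 'm \<Rightarrow> real) \<Rightarrow> (real ^ 'm) set \<Rightarrow> bool" where
  "C1_on f S \<longleftrightarrow> (\<forall>x\<in>S. f differentiable (at x)) \<and> continuous_on S (grad f)"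

end

theory Submission
  imports Defs
begin

text \<open>
  Write \<open>e\<^sub>n = \<theta>\<^sub>n - \<theta>'\<^sub>n\<close>. Subtracting the two schemes and inserting \<open>F (\<theta>'\<^sub>n)\<close> gives
  \<open>e\<^sub>n\<^sub>+\<^sub>1 = e\<^sub>n - h (F (\<theta>\<^sub>n) - F (\<theta>'\<^sub>n)) - h A\<^sub>n (grad H (\<theta>'\<^sub>n) - grad H (\<theta>'\<^sub>n\<^sub>+\<^sub>1))\<close>,
  where \<open>A\<^sub>n\<close> is the inverse of \<open>G (\<theta>'\<^sub>n)\<close>.
  The first increment has norm at most \<open>h L\<^sub>1 \<nu> e\<^sub>n\<close>. The second is the defect caused by taking the
  gradient one step later; it has norm at most \<open>h M\<^sub>1 L\<^sub>2 \<nu> (\<theta>'\<^sub>n - \<theta>'\<^sub>n\<^sub>+\<^sub>1)\<close>, and the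
  semi-implicit step itself has length at most \<open>h M\<^sub>1 M\<^sub>2\<close>. Hence
  \<open>\<nu> e\<^sub>n\<^sub>+\<^sub>1 \<le> (1 + L\<^sub>1 h) \<nu> e\<^sub>n + h\<^sup>2 M\<^sub>1\<^sup>2 M\<^sub>2 L\<^sub>2\<close>,
  and since \<open>e\<^sub>0 = 0\<close>, a geometric sum (\<open>affine_recursion_bound\<close>) yields the claim.

  The only analytic ingredient is \<open>\<nu> (A v) \<le> induced_norm \<nu> A * \<nu> v\<close> (\<open>induced_norm_bound\<close>). The
  induced norm is a supremum of reals, so this needs the quotients to be bounded, which is the
  equivalence of \<open>\<nu>\<close> with the Euclidean norm.
\<close>

section \<open>Norms on Euclidean space and their induced matrix norms\<close>

context
  fixes \<nu> :: "'a::real_vector \<Rightarrow> real"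
  assumes norm: "is_norm \<nu>"
begin

lemma is_norm_nonneg: "0 \<le> \<nu> x"
  and is_norm_eq_0_iff: "\<nu> x = 0 \<longleftrightarrow> x = 0"
  and is_norm_scaleR: "\<nu> (c *\<^sub>R x) = \<bar>c\<bar> * \<nu> x"
  and is_norm_triangle: "\<nu> (x + y) \<le> \<nu> x + \<nu> y"
  using norm by (auto simp: is_norm_def)

lemma is_norm_zero: "\<nu> 0 = 0"
  by (simp add: is_norm_eq_0_iff)

lemma is_norm_pos: "x \<noteq> 0 \<Longrightarrow> 0 < \<nu> x"
  using is_norm_nonneg[of x] is_norm_eq_0_iff[of x] by linarith

lemma is_norm_minus: "\<nu> (- x) = \<nu> x"
  using is_norm_scaleR[of "-1" x] by simp

lemma is_norm_triangle_diff: "\<nu> (x - y) \<le> \<nu> x + \<nu> y"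
  using is_norm_triangle[of x "- y"] is_norm_minus[of y] by simp

lemma is_norm_sum: "\<nu> (\<Sum>i\<in>I. f i) \<le> (\<Sum>i\<in>I. \<nu> (f i))"
proof (induction I rule: infinite_finite_induct)
  case (insert i I)
  then show ?case
    using is_norm_triangle[of "f i" "sum f I"] by simp
qed (simp_all add: is_norm_zero)

end

text \<open>Expand in the standard basis: \<open>\<nu> x \<le> \<Sum>\<^sub>b \<bar>x \<bullet> b\<bar> * \<nu> b\<close>.\<close>
lemma is_norm_le_norm:
  fixes \<nu> :: "'a::euclidean_space \<Rightarrow> real"
  assumes "is_norm \<nu>"
  obtains C where "\<And>x. \<nu> x \<le> C * norm x"
proof
  fix x :: 'a
  have "\<nu> x = \<nu> (\<Sum>b\<in>Basis. (x \<bullet> b) *\<^sub>R b)"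
    by (simp add: euclidean_representation)
  also have "\<dots> \<le> (\<Sum>b\<in>Basis. \<bar>x \<bullet> b\<bar> * \<nu> b)"
    using is_norm_sum[OF assms, of "\<lambda>b. (x \<bullet> b) *\<^sub>R b" Basis]
    by (simp add: is_norm_scaleR[OF assms])
  also have "\<dots> \<le> (\<Sum>b\<in>Basis. norm x * \<nu> b)"
    by (intro sum_mono mult_right_mono Basis_le_norm is_norm_nonneg[OF assms])
  finally show "\<nu> x \<le> (\<Sum>b\<in>Basis. \<nu> b) * norm x"
    by (simp add: sum_distrib_left mult.commute)
qed

lemma continuous_on_is_norm:
  fixes \<nu> :: "'a::euclidean_space \<Rightarrow> real"
  assumes "is_norm \<nu>"
  shows "continuous_on S \<nu>"
proof -
  obtain C where C: "\<And>x. \<nu> x \<le> C * norm x"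
    using is_norm_le_norm[OF assms] by blast
  have "\<bar>\<nu> y - \<nu> x\<bar> \<le> C * norm (y - x)" for x y
    using is_norm_triangle[OF assms, of "y - x" x] is_norm_triangle[OF assms, of "x - y" y]
      C[of "y - x"] C[of "x - y"] by (simp add: norm_minus_commute)
  then have bound: "dist (\<nu> y) (\<nu> x) \<le> \<bar>C\<bar> * dist y x" for x y
    by (smt (verit) dist_norm real_norm_def mult_right_mono norm_ge_zero)
  have "(\<bar>C\<bar>)-lipschitz_on S \<nu>"
    by (rule lipschitz_onI) (use bound in auto)
  then show ?thesis
    by (rule lipschitz_on_continuous_on)
qed

text \<open>The constant is the minimum of \<open>\<nu>\<close> on the Euclidean unit sphere, which is attained by
  compactness and hence positive.\<close>
lemma norm_le_is_norm:
  fixes \<nu> :: "'a::euclidean_space \<Rightarrow> real"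
  assumes "is_norm \<nu>"
  obtains c where "0 < c" "\<And>x. c * norm x \<le> \<nu> x"
proof -
  have "sphere (0::'a) 1 \<noteq> {}"
    by simp
  then obtain u where u: "u \<in> sphere 0 1" and min: "\<And>y. y \<in> sphere 0 1 \<Longrightarrow> \<nu> u \<le> \<nu> y"
    using continuous_attains_inf[OF compact_sphere _ continuous_on_is_norm[OF assms]] by blast
  show thesis
  proof
    show "0 < \<nu> u"
      using u by (intro is_norm_pos[OF assms]) auto
    fix x :: 'a
    show "\<nu> u * norm x \<le> \<nu> x"
    proof (cases "x = 0")
      case False
      then have "\<nu> u \<le> \<nu> ((1 / norm x) *\<^sub>R x)"
        by (intro min) simp
      then show ?thesis
        using False by (simp add: is_norm_scaleR[OF assms] field_simps)
    qed (simp add: is_norm_zero[OF assms])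
  qed
qed

text \<open>The upper estimate of \<open>\<nu>\<close> for the numerator and the lower one for the denominator bound the
  quotients, so that the supremum dominates each of them.\<close>
lemma induced_norm_bound:
  fixes \<nu> :: "real ^ 'm \<Rightarrow> real"
  assumes "is_norm \<nu>"
  shows "\<nu> (A *v v) \<le> induced_norm \<nu> A * \<nu> v"
proof (cases "v = 0")
  case False
  obtain C where C: "\<And>x. \<nu> x \<le> C * norm x"
    using is_norm_le_norm[OF assms] by blast
  obtain c where c: "0 < c" "\<And>x. c * norm x \<le> \<nu> x"
    using norm_le_is_norm[OF assms] by blast
  obtain B where B: "\<And>x. norm (A *v x) \<le> norm x * B" "0 < B"
    using bounded_linear.pos_bounded[OF matrix_vector_mul_bounded_linear[of A]] by blast
  have "\<nu> (A *v x) / \<nu> x \<le> \<bar>C\<bar> * B / c" if "x \<noteq> 0" for x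
  proof -
    have "\<nu> (A *v x) \<le> \<bar>C\<bar> * norm (A *v x)"
      by (rule order_trans[OF C]) (simp add: mult_right_mono)
    also have "\<dots> \<le> \<bar>C\<bar> * (norm x * B)"
      by (intro mult_left_mono B) simp
    also have "\<dots> = \<bar>C\<bar> * B / c * (c * norm x)"
      using c(1) by simp
    also have "\<dots> \<le> \<bar>C\<bar> * B / c * \<nu> x"
      using B(2) c by (intro mult_left_mono) auto
    finally show ?thesis
      using is_norm_pos[OF assms that] by (simp add: pos_divide_le_eq)
  qed
  then have "bdd_above ((\<lambda>x. \<nu> (A *v x) / \<nu> x) ` {x. x \<noteq> 0})"
    by (intro bdd_aboveI2) auto
  then have "\<nu> (A *v v) / \<nu> v \<le> induced_norm \<nu> A"
    unfolding induced_norm_def by (rule cSUP_upper[rotated]) (use False in simp)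
  then show ?thesis
    using is_norm_pos[OF assms False] by (simp add: pos_divide_le_eq)
qed (simp add: is_norm_zero[OF assms])

section \<open>Difference quotients and error recursion\<close>

text \<open>If the quotient is \<open>0 / 0\<close>, then \<open>x = y\<close> and both sides vanish.\<close>
lemma is_norm_diff_le_quotient_bound:
  assumes "is_norm \<mu>" and "is_norm \<nu>"
    and "\<mu> (f x - f y) / \<nu> (x - y) \<le> L"
  shows "\<mu> (f x - f y) \<le> L * \<nu> (x - y)"
proof (cases "x = y")
  case True
  then show ?thesis
    by (simp add: is_norm_zero[OF assms(1)] is_norm_zero[OF assms(2)])
next
  case False
  then show ?thesis
    using assms(3) is_norm_pos[OF assms(2), of "x - y"] by (simp add: pos_divide_le_eq)
qed

text \<open>Discrete Gronwall inequality: \<open>((1 + a) ^ n - 1) * (b / a)\<close> is the exact solution of the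
  recursion with equality started at \<open>0\<close>, namely \<open>b\<close> times the geometric sum of ratio \<open>1 + a\<close>.\<close>
lemma affine_recursion_bound:
  fixes e :: "nat \<Rightarrow> real"
  assumes "0 < a" and "e 0 \<le> 0"
    and step: "\<And>n. n < N \<Longrightarrow> e (Suc n) \<le> (1 + a) * e n + b"
  shows "n \<le> N \<Longrightarrow> e n \<le> ((1 + a) ^ n - 1) * (b / a)"
proof (induction n)
  case (Suc n)
  have "e (Suc n) \<le> (1 + a) * e n + b"
    using Suc.prems by (intro step) simp
  also have "\<dots> \<le> (1 + a) * (((1 + a) ^ n - 1) * (b / a)) + b"
    using Suc assms(1) by (intro add_right_mono mult_left_mono) auto
  also have "\<dots> = ((1 + a) ^ Suc n - 1) * (b / a)"
    using assms(1) by (simp add: field_simps)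
  finally show ?case .
qed (use assms(2) in simp)

section \<open>Distance between the two Euler schemes\<close>

theorem theorem5p22:
  fixes \<Theta> :: "(real ^ 'm) set"
    and G :: "real ^ 'm \<Rightarrow> real ^ 'm ^ 'm"
    and H :: "real ^ 'm \<Rightarrow> real"
    and F :: "real ^ 'm \<Rightarrow> real ^ 'm"
    and \<nu> :: "real ^ 'm \<Rightarrow> real"
    and \<theta> \<theta>' :: "nat \<Rightarrow> real ^ 'm"
    and T h L1 L2 M1 M2 :: real
    and N :: nat
  assumes "open \<Theta>" and "convex \<Theta>"
    and "\<forall>x\<in>\<Theta>. pos_def_sym (G x)"
    and "C1_on H \<Theta>"
    and "is_norm \<nu>"
    and "T > 0" and "N \<ge> 1" and "h = T / real N"
    and "\<forall>n\<le>N. \<theta> n \<in> \<Theta>" and "\<forall>n\<le>N. \<theta>' n \<in> \<Theta>"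
    and "\<theta> 0 = \<theta>' 0"
    and forward_Euler:
      "\<forall>n<N. \<theta> (Suc n) = \<theta> n - h *\<^sub>R (matrix_inv (G (\<theta> n)) *v grad H (\<theta> n))"
    and semi_implicit_Euler:
      "\<forall>n<N. \<theta>' (Suc n) = \<theta>' n - h *\<^sub>R (matrix_inv (G (\<theta>' n)) *v grad H (\<theta>' (Suc n)))"
    and "\<forall>x\<in>\<Theta>. F x = matrix_inv (G x) *v grad H x"
    and "L1 = (MAX n\<in>{0..N - 1}. \<nu> (F (\<theta> n) - F (\<theta>' n)) / \<nu> (\<theta> n - \<theta>' n))"
    and "L2 = (MAX n\<in>{0..N - 1}.
                 \<nu> (grad H (\<theta>' n) - grad H (\<theta>' (n + 1))) / \<nu> (\<theta>' n - \<theta>' (n + 1)))"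
    and "M1 = (MAX n\<in>{0..N - 1}. induced_norm \<nu> (matrix_inv (G (\<theta>' n))))"
    and "M2 = (MAX n\<in>{1..N}. \<nu> (grad H (\<theta>' n)))"
    and "L1 > 0"
  shows "\<forall>n\<in>{1..N}. \<nu> (\<theta> n - \<theta>' n) \<le> ((1 + L1 * h) ^ n - 1) * (M1\<^sup>2 * M2 * L2 / L1) * h"
proof -
  note norm = assms(5)
  have h: "0 < h"
    using assms(6-8) by simp
  have in_range: "n \<in> {0..N - 1}" if "n < N" for n
    using that by auto
  have L1: "\<nu> (F (\<theta> n) - F (\<theta>' n)) \<le> L1 * \<nu> (\<theta> n - \<theta>' n)" if "n < N" for n
  proof (rule is_norm_diff_le_quotient_bound[OF norm norm])
    show "\<nu> (F (\<theta> n) - F (\<theta>' n)) / \<nu> (\<theta> n - \<theta>' n) \<le> L1"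
      unfolding assms(15) by (rule Max_ge) (use in_range[OF that] in auto)
  qed
  have L2_ge: "\<nu> (grad H (\<theta>' n) - grad H (\<theta>' (n + 1))) / \<nu> (\<theta>' n - \<theta>' (n + 1)) \<le> L2"
    if "n < N" for n
    unfolding assms(16) by (rule Max_ge) (use in_range[OF that] in auto)
  have L2: "\<nu> (grad H (\<theta>' n) - grad H (\<theta>' (Suc n))) \<le> L2 * \<nu> (\<theta>' n - \<theta>' (Suc n))"
    if "n < N" for n
    using is_norm_diff_le_quotient_bound[OF norm norm L2_ge[OF that]] by simp
  have M1: "\<nu> (matrix_inv (G (\<theta>' n)) *v v) \<le> M1 * \<nu> v" if "n < N" for n v
  proof -
    have "induced_norm \<nu> (matrix_inv (G (\<theta>' n))) \<le> M1"
      unfolding assms(17) by (rule Max_ge) (use in_range[OF that] in auto)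
    then show ?thesis
      by (rule order_trans[OF induced_norm_bound[OF norm] mult_right_mono[OF _ is_norm_nonneg[OF norm]]])
  qed
  have M2: "\<nu> (grad H (\<theta>' (Suc n))) \<le> M2" if "n < N" for n
    unfolding assms(18) by (rule Max_ge) (use that in auto)
  have "0 < N"
    using assms(7) by simp
  then have "0 \<le> L2"
    using L2_ge[of 0] is_norm_nonneg[OF norm]
    by (meson divide_nonneg_nonneg order_trans)
  (* M1 is tested on a nonzero vector, which exists since the index type is nonempty. *)
  have "0 \<le> M1"
  proof -
    obtain v :: "real ^ 'm" where "v \<noteq> 0"
      using nonzero_Basis nonempty_Basis by blast
    have "0 \<le> M1 * \<nu> v"
      using M1[OF \<open>0 < N\<close>, of v] is_norm_nonneg[OF norm] order_trans by blast
    then show ?thesis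
      using is_norm_pos[OF norm \<open>v \<noteq> 0\<close>] by (simp add: zero_le_mult_iff)
  qed

  have step: "\<nu> (\<theta> (Suc n) - \<theta>' (Suc n))
      \<le> (1 + L1 * h) * \<nu> (\<theta> n - \<theta>' n) + h\<^sup>2 * (M1\<^sup>2 * M2 * L2)" if "n < N" for n
  proof -
    define A where "A = matrix_inv (G (\<theta>' n))"
    define d where "d = grad H (\<theta>' n) - grad H (\<theta>' (Suc n))"
    have F: "F (\<theta> n) = matrix_inv (G (\<theta> n)) *v grad H (\<theta> n)" "F (\<theta>' n) = A *v grad H (\<theta>' n)"
      using assms(9,10,14) that by (auto simp: A_def)
    have steps: "\<theta> (Suc n) = \<theta> n - h *\<^sub>R F (\<theta> n)"
      "\<theta>' (Suc n) = \<theta>' n - h *\<^sub>R (A *v grad H (\<theta>' (Suc n)))"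
      using forward_Euler semi_implicit_Euler that by (auto simp: F A_def)
    have "\<nu> (\<theta>' n - \<theta>' (Suc n)) = h * \<nu> (A *v grad H (\<theta>' (Suc n)))"
      using h by (subst steps(2)) (simp add: is_norm_scaleR[OF norm])
    also have "\<dots> \<le> h * (M1 * M2)"
      unfolding A_def using h \<open>0 \<le> M1\<close>
      by (intro mult_left_mono order_trans[OF M1[OF that]] M2[OF that]) auto
    finally have increment: "\<nu> (\<theta>' n - \<theta>' (Suc n)) \<le> h * (M1 * M2)" .
    have "\<nu> (A *v d) \<le> M1 * \<nu> d"
      unfolding A_def by (rule M1[OF that])
    also have "\<dots> \<le> M1 * (L2 * (h * (M1 * M2)))"
      unfolding d_def
      by (intro mult_left_mono order_trans[OF L2[OF that]] increment \<open>0 \<le> M1\<close> \<open>0 \<le> L2\<close>)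
    finally have defect: "\<nu> (A *v d) \<le> M1 * (L2 * (h * (M1 * M2)))" .
    have "\<theta> (Suc n) - \<theta>' (Suc n)
        = (\<theta> n - \<theta>' n) - h *\<^sub>R (F (\<theta> n) - F (\<theta>' n)) - h *\<^sub>R (A *v d)"
      by (subst steps(1), subst steps(2))
        (simp add: F(2) d_def matrix_vector_mult_diff_distrib scaleR_diff_right)
    then have "\<nu> (\<theta> (Suc n) - \<theta>' (Suc n))
        \<le> \<nu> (\<theta> n - \<theta>' n) + \<nu> (h *\<^sub>R (F (\<theta> n) - F (\<theta>' n))) + \<nu> (h *\<^sub>R (A *v d))"
      using is_norm_triangle_diff[OF norm] by (metis add_mono_thms_linordered_semiring(3) order_trans)
    also have "\<dots> = \<nu> (\<theta> n - \<theta>' n) + h * \<nu> (F (\<theta> n) - F (\<theta>' n)) + h * \<nu> (A *v d)"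
      using h by (simp add: is_norm_scaleR[OF norm])
    also have "\<dots> \<le> \<nu> (\<theta> n - \<theta>' n) + h * (L1 * \<nu> (\<theta> n - \<theta>' n))
        + h * (M1 * (L2 * (h * (M1 * M2))))"
      using h by (intro add_mono mult_left_mono L1[OF that] defect) auto
    also have "\<dots> = (1 + L1 * h) * \<nu> (\<theta> n - \<theta>' n) + h\<^sup>2 * (M1\<^sup>2 * M2 * L2)"
      by (simp add: power2_eq_square algebra_simps)
    finally show ?thesis .
  qed
  have "\<nu> (\<theta> n - \<theta>' n) \<le> ((1 + L1 * h) ^ n - 1) * (M1\<^sup>2 * M2 * L2 / L1) * h" if "n \<le> N" for n
  proof -
    have "\<nu> (\<theta> n - \<theta>' n) \<le> ((1 + L1 * h) ^ n - 1) * (h\<^sup>2 * (M1\<^sup>2 * M2 * L2) / (L1 * h))"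
      by (rule affine_recursion_bound[where e = "\<lambda>n. \<nu> (\<theta> n - \<theta>' n)", OF _ _ step that])
        (use h \<open>L1 > 0\<close> assms(11) in \<open>auto simp: is_norm_zero[OF norm]\<close>)
    also have "h\<^sup>2 * (M1\<^sup>2 * M2 * L2) / (L1 * h) = M1\<^sup>2 * M2 * L2 / L1 * h"
      using h by (simp add: power2_eq_square)
    finally show ?thesis
      by (simp only: mult.assoc)
  qed
  then show ?thesis
    by simp
qed

end
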